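(* Consider the autoregressive process $X_k=\theta X_{k-1}+\varepsilon_k$, $k\in[1,n]$, with unknown parameter $\theta\in\mathbf{R}$ and least-squares estimator $$\theta_n'=\frac{\sum_{k=1}^nX_kX_{k-1}}{\sum_{k=1}^nX_{k-1}^2}.$$ Assume that there exist $\alpha\in(1,2]$ and $c>0$ such that $$\mathbf{E}e^{\lambda\varepsilon_i}\le e^{c|\lambda|^\alpha}\quad\text{for all } i\in[1,n]\ \text{and all}\ \lambda\in\mathbf{R}.$$ Then, for all $x\ge0$ and $v>0$ and for each choice of sign $\pm$, $$\mathbf{P}\left(\pm(\theta_n'-\theta)\sum_{k=1}^nX_{k-1}^2\ge x\ \text{and}\ \sum_{k=1}^n|X_{k-1}|^\alpha\le v^\alpha\right)\le\exp\left\{-C(\alpha)\left(\frac{x}{v}\right)^{\frac{\alpha}{\alpha-1}}\right\},$$ where $$C(\alpha)=(c\,\alpha)^{\frac{1}{1-\alpha}}\left(1-\alpha^{-1}\right).$$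
   Context: $(X_k)$ and $(\varepsilon_k)$ are the real-valued observations and driven noises. $(\varepsilon_k)$ is a sequence of i.i.d. centered random variables with variance $\sigma^2>0$, and the initial value $X_0$ is a real random variable independent of $(\varepsilon_k)$. It is understood that $\sum_{k=1}^nX_{k-1}^2>0$ a.s., so that $\theta_n'$ is defined. *)

theory Defs
  imports "HOL-Probability.Probability"
begin

(* Independence of two random elements whose value types may differ; prob_space.indep_var
   is this notion restricted to a common value type (see prob_space.indep_var_eq). *)
definition indep_rv :: "'a measure \<Rightarrow> 'b measure \<Rightarrow> ('a \<Rightarrow> 'b) \<Rightarrow> 'c measure \<Rightarrow> ('a \<Rightarrow> 'c) \<Rightarrow> bool" where
  "indep_rv M S f T g \<longleftrightarrow>
     f \<in> measurable M S \<and> g \<in> measurable M T \<and>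
     prob_space.indep_set M
       (sets (vimage_algebra (space M) f S)) (sets (vimage_algebra (space M) g T))"

definition lse :: "(nat \<Rightarrow> 'a \<Rightarrow> real) \<Rightarrow> nat \<Rightarrow> 'a \<Rightarrow> real" where
  "lse X n \<omega> = (\<Sum>k=1..n. X k \<omega> * X (k - 1) \<omega>) / (\<Sum>k=1..n. (X (k - 1) \<omega>)\<^sup>2)"

definition rate_const :: "real \<Rightarrow> real \<Rightarrow> real" where
  "rate_const c \<alpha> = (c * \<alpha>) powr (1 / (1 - \<alpha>)) * (1 - 1 / \<alpha>)"

end

theory Submission
  imports Defs
begin

text \<open>
  Almost surely \<open>(\<theta>\<^sub>n' - \<theta>) \<Sum> X\<^sub>k\<^sub>-\<^sub>1\<^sup>2 = \<Sum> X\<^sub>k\<^sub>-\<^sub>1 \<epsilon>\<^sub>k\<close>. Since \<open>\<epsilon>\<^sub>k\<close> is independent of \<open>X\<^sub>k\<^sub>-\<^sub>1\<close>, the moment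
  bound makes \<open>exp (\<Sum> (t X\<^sub>k\<^sub>-\<^sub>1 \<epsilon>\<^sub>k - c |t X\<^sub>k\<^sub>-\<^sub>1|\<^sup>\<alpha>))\<close> a supermartingale with mean at most 1.
  Conditional expectations are avoided: \<open>(X\<^sub>0, \<epsilon>\<^sub>1, \<dots>, \<epsilon>\<^sub>n)\<close> has a product law, and the noise
  variables are integrated out one at a time, last one first. On the event in question the
  supermartingale with \<open>|t| = l\<close> is at least \<open>exp (l x - c l\<^sup>\<alpha> v\<^sup>\<alpha>)\<close>; it remains to optimise over \<open>l\<close>.
\<close>

text \<open>Measurable rectangles generate the product sigma-algebra, and independence makes the two
  measures agree on them. It is meant for \<open>X 0\<close> and the whole noise vector, whose value
  types differ.\<close>

lemma distr_pair_indep_rv: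
  assumes "prob_space M" and "indep_rv M S f T g"
  shows "distr M (S \<Otimes>\<^sub>M T) (\<lambda>\<omega>. (f \<omega>, g \<omega>)) = distr M S f \<Otimes>\<^sub>M distr M T g"
proof (rule sym, rule pair_measure_eqI)
  interpret prob_space M by fact
  have [measurable]: "f \<in> measurable M S" "g \<in> measurable M T"
    using assms(2) by (auto simp: indep_rv_def)
  show "sigma_finite_measure (distr M S f)" "sigma_finite_measure (distr M T g)"
    by (intro prob_space_imp_sigma_finite prob_space_distr; measurable)+
  show "sets (distr M S f \<Otimes>\<^sub>M distr M T g) = sets (distr M (S \<Otimes>\<^sub>M T) (\<lambda>\<omega>. (f \<omega>, g \<omega>)))"
    by (simp cong: sets_pair_measure_cong)
  fix A B assume "A \<in> sets (distr M S f)" "B \<in> sets (distr M T g)"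
  then have [measurable]: "A \<in> sets S" "B \<in> sets T" by simp_all
  have "prob ((f -` A \<inter> space M) \<inter> (g -` B \<inter> space M)) = prob (f -` A \<inter> space M) * prob (g -` B \<inter> space M)"
    using assms(2) unfolding indep_rv_def
    by (intro indep_setD) (auto intro!: in_vimage_algebra)
  moreover have "(\<lambda>\<omega>. (f \<omega>, g \<omega>)) -` (A \<times> B) \<inter> space M = (f -` A \<inter> space M) \<inter> (g -` B \<inter> space M)"
    by auto
  ultimately show "emeasure (distr M S f) A * emeasure (distr M T g) B
      = emeasure (distr M (S \<Otimes>\<^sub>M T) (\<lambda>\<omega>. (f \<omega>, g \<omega>))) (A \<times> B)"
    by (simp add: emeasure_distr emeasure_eq_measure ennreal_mult')
qed

text \<open>The observations as a deterministic function of the initial value and the noise vector,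
  so that expectations become integrals over a product law. The entry \<open>e 0\<close> is never
  read.\<close>

fun ar :: "real \<Rightarrow> real \<Rightarrow> (nat \<Rightarrow> real) \<Rightarrow> nat \<Rightarrow> real" where
  "ar \<theta> x0 e 0 = x0"
| "ar \<theta> x0 e (Suc k) = \<theta> * ar \<theta> x0 e k + e (Suc k)"

text \<open>Non-anticipation, the deterministic form of adaptedness: it lets a later noise be
  integrated out while the path so far stays frozen.\<close>

lemma ar_cong:
  assumes "\<And>i. i \<in> {1..k} \<Longrightarrow> e i = e' i"
  shows "ar \<theta> x0 e k = ar \<theta> x0 e' k"
  using assms by (induction k) auto

lemma measurable_ar [measurable]:
  assumes "k \<le> n"
  shows "(\<lambda>p. ar \<theta> (fst p) (snd p) k) \<in> borel_measurable (borel \<Otimes>\<^sub>M PiM {1..n} (\<lambda>_. borel))"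
  using assms
proof (induction k)
  case (Suc k)
  then have [measurable]: "(\<lambda>p. ar \<theta> (fst p) (snd p) k) \<in> borel_measurable (borel \<Otimes>\<^sub>M PiM {1..n} (\<lambda>_. borel))"
    by simp
  have [measurable]: "(\<lambda>e. e (Suc k)) \<in> borel_measurable (PiM {1..n} (\<lambda>_. borel :: real measure))"
    using Suc.prems by (intro measurable_component_singleton) auto
  show ?case unfolding ar.simps by measurable
qed simp

text \<open>The exponential supermartingale with tilt \<open>t\<close>. Each subtracted term is the
  assumed bound on the log moment generating function of \<open>e i\<close> at the argument
  \<open>t * ar \<theta> x0 e (i - 1)\<close>.\<close>

definition ar_expmart :: "real \<Rightarrow> real \<Rightarrow> real \<Rightarrow> real \<Rightarrow> nat \<Rightarrow> real \<Rightarrow> (nat \<Rightarrow> real) \<Rightarrow> real" where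
  "ar_expmart c \<alpha> \<theta> t k x0 e =
     exp (\<Sum>i=1..k. t * ar \<theta> x0 e (i - 1) * e i - c * \<bar>t * ar \<theta> x0 e (i - 1)\<bar> powr \<alpha>)"

lemma measurable_ar_expmart:
  "(\<lambda>p. ar_expmart c \<alpha> \<theta> t n (fst p) (snd p)) \<in> borel_measurable (borel \<Otimes>\<^sub>M PiM {1..n} (\<lambda>_. borel))"
proof -
  have [measurable]: "(\<lambda>p. ar \<theta> (fst p) (snd p) (i - 1)) \<in> borel_measurable (borel \<Otimes>\<^sub>M PiM {1..n} (\<lambda>_. borel))"
    if "i \<in> {1..n}" for i
    using that by (intro measurable_ar) auto
  have [measurable]: "(\<lambda>e. e i) \<in> borel_measurable (PiM {1..n} (\<lambda>_. borel :: real measure))"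
    if "i \<in> {1..n}" for i
    using that by (rule measurable_component_singleton)
  show ?thesis
    unfolding ar_expmart_def by measurable
qed

lemma measurable_ar_expmart_snd:
  assumes "sets D = sets borel"
  shows "ar_expmart c \<alpha> \<theta> t n x0 \<in> borel_measurable (PiM {1..n} (\<lambda>_. D))"
proof -
  have "(\<lambda>e. (x0, e)) \<in> PiM {1..n} (\<lambda>_. borel) \<rightarrow>\<^sub>M borel \<Otimes>\<^sub>M PiM {1..n} (\<lambda>_. borel :: real measure)"
    by measurable
  from measurable_compose[OF this measurable_ar_expmart]
  have "ar_expmart c \<alpha> \<theta> t n x0 \<in> borel_measurable (PiM {1..n} (\<lambda>_. borel))"
    by simp
  also have "borel_measurable (PiM {1..n} (\<lambda>_. borel)) = borel_measurable (PiM {1..n} (\<lambda>_. D))"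
    by (intro measurable_cong_sets sets_PiM_cong) (simp_all add: assms)
  finally show ?thesis .
qed

text \<open>By non-anticipation the new noise \<open>y\<close> leaves the first \<open>k\<close>
  summands alone and enters the last one linearly; it is isolated in one factor, ready for
  integration over \<open>y\<close>.\<close>

lemma ar_expmart_upd:
  "ar_expmart c \<alpha> \<theta> t (Suc k) x0 (e(Suc k := y)) =
     ar_expmart c \<alpha> \<theta> t k x0 e * exp (t * ar \<theta> x0 e k * y) * exp (- (c * \<bar>t * ar \<theta> x0 e k\<bar> powr \<alpha>))"
proof -
  have "ar \<theta> x0 (e(Suc k := y)) i = ar \<theta> x0 e i" if "i \<le> k" for i
    using that by (intro ar_cong) auto
  then have "(\<Sum>i=1..k. t * ar \<theta> x0 (e(Suc k := y)) (i - 1) * (e(Suc k := y)) i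
        - c * \<bar>t * ar \<theta> x0 (e(Suc k := y)) (i - 1)\<bar> powr \<alpha>)
      = (\<Sum>i=1..k. t * ar \<theta> x0 e (i - 1) * e i - c * \<bar>t * ar \<theta> x0 e (i - 1)\<bar> powr \<alpha>)"
    and "ar \<theta> x0 (e(Suc k := y)) k = ar \<theta> x0 e k"
    by (auto intro!: sum.cong)
  then show ?thesis
    by (simp add: ar_expmart_def flip: exp_add)
qed

text \<open>With the earlier noises frozen, the coefficient of the last noise is a constant, and
  \<open>mgf\<close> at this constant cancels the subtracted term. Fixing \<open>x0\<close> plays
  the part of conditioning on the initial value.\<close>

lemma nn_integral_ar_expmart_le_1:
  assumes "prob_space D" and sets_D [measurable_cong]: "sets D = sets borel"
    and mgf: "\<And>t. (\<integral>\<^sup>+ y. ennreal (exp (t * y)) \<partial>D) \<le> ennreal (exp (c * \<bar>t\<bar> powr \<alpha>))"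
  shows "(\<integral>\<^sup>+ e. ennreal (ar_expmart c \<alpha> \<theta> t k x0 e) \<partial>PiM {1..k} (\<lambda>_. D)) \<le> 1"
proof -
  interpret D: prob_space D by fact
  interpret product_prob_space "\<lambda>_::nat. D" ..
  show ?thesis
  proof (induction k)
    case 0
    show ?case by (simp add: ar_expmart_def PiM_empty nn_integral_count_space_finite)
  next
    case (Suc k)
    let ?W = "ar_expmart c \<alpha> \<theta> t"
    \<comment> \<open>Tonelli, with the last coordinate \<open>Suc k\<close> innermost.\<close>
    have "(\<integral>\<^sup>+ e. ennreal (?W (Suc k) x0 e) \<partial>PiM {1..Suc k} (\<lambda>_. D)) =
        (\<integral>\<^sup>+ e. \<integral>\<^sup>+ y. ennreal (?W (Suc k) x0 (e(Suc k := y))) \<partial>D \<partial>PiM {1..k} (\<lambda>_. D))"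
      using measurable_ar_expmart_snd[OF sets_D, where n = "Suc k"]
      by (simp add: atLeastAtMostSuc_conv product_nn_integral_insert)
    also have "\<dots> \<le> (\<integral>\<^sup>+ e. ennreal (?W k x0 e) \<partial>PiM {1..k} (\<lambda>_. D))"
    proof (rule nn_integral_mono)
      fix e :: "nat \<Rightarrow> real"
      let ?u = "t * ar \<theta> x0 e k"
      let ?a = "?W k x0 e * exp (- (c * \<bar>?u\<bar> powr \<alpha>))"
      have pos: "?W k x0 e \<ge> 0" by (simp add: ar_expmart_def)
      have "(\<integral>\<^sup>+ y. ennreal (?W (Suc k) x0 (e(Suc k := y))) \<partial>D)
          = (\<integral>\<^sup>+ y. ennreal ?a * ennreal (exp (?u * y)) \<partial>D)"
        using pos by (simp add: ar_expmart_upd mult_ac flip: ennreal_mult)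
      also have "\<dots> = ennreal ?a * (\<integral>\<^sup>+ y. ennreal (exp (?u * y)) \<partial>D)"
        by (rule nn_integral_cmult) measurable
      also have "\<dots> \<le> ennreal ?a * ennreal (exp (c * \<bar>?u\<bar> powr \<alpha>))"
        by (intro mult_left_mono mgf) simp
      also have "\<dots> = ennreal (?W k x0 e)"
        using pos by (simp add: exp_minus flip: ennreal_mult)
      finally show "(\<integral>\<^sup>+ y. ennreal (?W (Suc k) x0 (e(Suc k := y))) \<partial>D) \<le> ennreal (?W k x0 e)" .
    qed
    also note Suc.IH
    finally show ?case .
  qed
qed

text \<open>Here \<open>l\<close> is the stationary point of the left-hand side:
  \<open>c * \<alpha> * l powr (\<alpha> - 1) * v powr \<alpha> = x\<close>. At it the first term
  equals \<open>l * x / \<alpha>\<close>, whence the factor \<open>1 - 1 / \<alpha>\<close> in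
  \<open>rate_const\<close>.\<close>

lemma chernoff_exponent:
  fixes c \<alpha> v x l :: real
  assumes "1 < \<alpha>" "c > 0" "v > 0" "x > 0"
  defines "l \<equiv> (x / (c * \<alpha> * v powr \<alpha>)) powr (1 / (\<alpha> - 1))"
  shows "c * l powr \<alpha> * v powr \<alpha> - l * x = - rate_const c \<alpha> * (x / v) powr (\<alpha> / (\<alpha> - 1))"
proof -
  define b where "b = 1 / (\<alpha> - 1)"
  have b: "\<alpha> / (\<alpha> - 1) = 1 + b" "1 / (1 - \<alpha>) = - b" "\<alpha> * b = 1 + b" "(\<alpha> - 1) * b = 1"
    using assms by (auto simp: b_def field_simps)
  have "l powr \<alpha> = l * l powr (\<alpha> - 1)"
    using assms by (simp add: powr_mult_base)
  also have "l powr (\<alpha> - 1) = x / (c * \<alpha> * v powr \<alpha>)"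
    using assms by (simp add: powr_powr)
  finally have "c * l powr \<alpha> * v powr \<alpha> - l * x = - (1 - 1 / \<alpha>) * (l * x)"
    using assms by (simp add: field_simps)
  \<comment> \<open>The power of \<open>v\<close> comes from \<open>\<alpha> * b = 1 + b\<close>,
    and \<open>x * x powr b\<close> has the same exponent.\<close>
  moreover have "l * x = (c * \<alpha>) powr (- b) * (x / v) powr (1 + b)"
  proof -
    have "l = x powr b / ((c * \<alpha>) powr b * v powr (1 + b))"
      using assms b(3) by (simp add: l_def b_def[symmetric] powr_divide powr_mult powr_powr)
    then show ?thesis
      using assms by (simp add: powr_divide powr_add powr_minus field_simps)
  qed
  ultimately show ?thesis
    by (simp add: rate_const_def b algebra_simps)
qed

theorem theorem3p5:
  fixes M :: "'a measure"
    and X \<epsilon> :: "nat \<Rightarrow> 'a \<Rightarrow> real"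
    and n :: nat
    and \<theta> \<sigma> \<alpha> c x v s :: real
  assumes "prob_space M"
    and "prob_space.indep_vars M (\<lambda>_. borel) \<epsilon> {1..n}"
    and "\<And>i j. i \<in> {1..n} \<Longrightarrow> j \<in> {1..n} \<Longrightarrow> distr M borel (\<epsilon> i) = distr M borel (\<epsilon> j)"
    and "\<And>i. i \<in> {1..n} \<Longrightarrow> integrable M (\<epsilon> i)"
    and "\<And>i. i \<in> {1..n} \<Longrightarrow> prob_space.expectation M (\<epsilon> i) = 0"
    and "\<sigma> > 0"
    and "\<And>i. i \<in> {1..n} \<Longrightarrow> integrable M (\<lambda>\<omega>. (\<epsilon> i \<omega>)\<^sup>2)"
    and "\<And>i. i \<in> {1..n} \<Longrightarrow> prob_space.variance M (\<epsilon> i) = \<sigma>\<^sup>2"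
    and "indep_rv M borel (X 0)
           (PiM {1..n} (\<lambda>_. borel)) (\<lambda>\<omega>. \<lambda>k\<in>{1..n}. \<epsilon> k \<omega>)"
    and "\<And>k \<omega>. k \<in> {1..n} \<Longrightarrow> \<omega> \<in> space M \<Longrightarrow> X k \<omega> = \<theta> * X (k - 1) \<omega> + \<epsilon> k \<omega>"
    and "AE \<omega> in M. (\<Sum>k=1..n. (X (k - 1) \<omega>)\<^sup>2) > 0"
    and "1 < \<alpha>" and "\<alpha> \<le> 2" and "c > 0"
    and "\<And>i t. i \<in> {1..n} \<Longrightarrow> integrable M (\<lambda>\<omega>. exp (t * \<epsilon> i \<omega>))"
    and "\<And>i t. i \<in> {1..n} \<Longrightarrow>
           prob_space.expectation M (\<lambda>\<omega>. exp (t * \<epsilon> i \<omega>)) \<le> exp (c * \<bar>t\<bar> powr \<alpha>)"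
    and "x \<ge> 0" and "v > 0" and "s \<in> {1, -1}"
  shows "prob_space.prob M
           {\<omega> \<in> space M. s * (lse X n \<omega> - \<theta>) * (\<Sum>k=1..n. (X (k - 1) \<omega>)\<^sup>2) \<ge> x
              \<and> (\<Sum>k=1..n. \<bar>X (k - 1) \<omega>\<bar> powr \<alpha>) \<le> v powr \<alpha>}
         \<le> exp (- rate_const c \<alpha> * (x / v) powr (\<alpha> / (\<alpha> - 1)))"
proof -
  let ?A = "{\<omega> \<in> space M. s * (lse X n \<omega> - \<theta>) * (\<Sum>k=1..n. (X (k - 1) \<omega>)\<^sup>2) \<ge> x
              \<and> (\<Sum>k=1..n. \<bar>X (k - 1) \<omega>\<bar> powr \<alpha>) \<le> v powr \<alpha>}"
  let ?E = "\<lambda>\<omega>. \<lambda>k\<in>{1..n}. \<epsilon> k \<omega>"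
  let ?Q = "PiM {1..n} (\<lambda>_. borel :: real measure)"
  interpret prob_space M by fact
  \<comment> \<open>For \<open>x = 0\<close> the bound is 1. For a non-measurable event
    \<open>prob\<close> takes its default value 0, so measurability can simply be assumed in the
    main case.\<close>
  consider "x = 0" | "?A \<notin> sets M" | "x > 0" "?A \<in> sets M"
    using \<open>x \<ge> 0\<close> by force
  then show ?thesis
  proof cases
    case 1
    then show ?thesis by simp
  next
    case 2
    then show ?thesis by (simp add: measure_notin_sets)
  next
    case 3
    define l where "l = (x / (c * \<alpha> * v powr \<alpha>)) powr (1 / (\<alpha> - 1))"
    have l: "l \<ge> 0" by (simp add: l_def)
    have exponent: "c * l powr \<alpha> * v powr \<alpha> - l * x = - rate_const c \<alpha> * (x / v) powr (\<alpha> / (\<alpha> - 1))"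
      unfolding l_def by (rule chernoff_exponent) (use assms 3 in auto)
    \<comment> \<open>For \<open>n = 0\<close> the sum of squares is empty, hence never
      positive.\<close>
    have "n \<noteq> 0"
      using assms(11) by (cases n) auto
    define D where "D = distr M borel (\<epsilon> 1)"
    \<comment> \<open>The sign goes into the tilt \<open>s * l\<close>; the subtracted terms only
      see its absolute value \<open>l\<close>, so both tails are treated at once.\<close>
    let ?W = "ar_expmart c \<alpha> \<theta> (s * l) n"
    let ?K = "exp (c * l powr \<alpha> * v powr \<alpha> - l * x)"
    have rv [measurable]: "\<epsilon> i \<in> borel_measurable M" if "i \<in> {1..n}" for i
      using assms(4)[OF that] by (rule borel_measurable_integrable)
    have rv1: "\<epsilon> 1 \<in> borel_measurable M" 
      using \<open>n \<noteq> 0\<close> by (intro rv) auto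
    have [measurable]: "X 0 \<in> borel_measurable M" "?E \<in> measurable M ?Q"
      using assms(9) by (simp_all add: indep_rv_def)
    have D: "prob_space D" "sets D = sets borel"
      unfolding D_def using rv1 by (auto intro: prob_space_distr)
    \<comment> \<open>Integrability turns the bound on the expectation, which would otherwise
      default to 0, into a bound on the nonnegative integral.\<close>
    have mgf: "(\<integral>\<^sup>+ y. ennreal (exp (t * y)) \<partial>D) \<le> ennreal (exp (c * \<bar>t\<bar> powr \<alpha>))" for t
    proof -
      have "(\<integral>\<^sup>+ y. ennreal (exp (t * y)) \<partial>D) = (\<integral>\<^sup>+ \<omega>. ennreal (exp (t * \<epsilon> 1 \<omega>)) \<partial>M)"
        unfolding D_def using rv1 by (subst nn_integral_distr) auto
      also have "\<dots> = ennreal (expectation (\<lambda>\<omega>. exp (t * \<epsilon> 1 \<omega>)))"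
        using \<open>n \<noteq> 0\<close> by (intro nn_integral_eq_integral assms(15)) auto
      finally show ?thesis
        using assms(16)[of 1 t] \<open>n \<noteq> 0\<close> by (simp add: ennreal_leI)
    qed
    have "distr M ?Q ?E = PiM {1..n} (\<lambda>i. distr M borel (\<epsilon> i))"
      using assms(2) rv \<open>n \<noteq> 0\<close> by (subst (asm) indep_vars_iff_distr_eq_PiM') auto
    also have "\<dots> = PiM {1..n} (\<lambda>_. D)"
      unfolding D_def using \<open>n \<noteq> 0\<close> by (intro PiM_cong assms(3)) auto
    finally have law_E: "distr M ?Q ?E = PiM {1..n} (\<lambda>_. D)" .
    \<comment> \<open>The restricted noise vector agrees with \<open>\<epsilon>\<close> only on
      \<open>{1..n}\<close>, hence the limit \<open>k \<le> n\<close>.\<close>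
    have path: "X k \<omega> = ar \<theta> (X 0 \<omega>) (?E \<omega>) k" if "k \<le> n" "\<omega> \<in> space M" for k \<omega>
      using that(1)
    proof (induction k)
      case (Suc k)
      then show ?case using assms(10)[of "Suc k" \<omega>] that(2) by simp
    qed simp
    have W_eq: "?W (X 0 \<omega>) (?E \<omega>) = exp (s * l * (\<Sum>k=1..n. X (k - 1) \<omega> * \<epsilon> k \<omega>)
        - c * l powr \<alpha> * (\<Sum>k=1..n. \<bar>X (k - 1) \<omega>\<bar> powr \<alpha>))" if "\<omega> \<in> space M" for \<omega>
    proof -
      have "\<bar>s * l\<bar> = l" using \<open>s \<in> {1, -1}\<close> l by auto
      have "ar \<theta> (X 0 \<omega>) (?E \<omega>) (k - 1) = X (k - 1) \<omega>" if "k \<in> {1..n}" for k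
        using that \<open>\<omega> \<in> space M\<close> by (intro path[symmetric]) auto
      then have "?W (X 0 \<omega>) (?E \<omega>) = exp (\<Sum>k=1..n. s * l * X (k - 1) \<omega> * \<epsilon> k \<omega>
          - c * \<bar>s * l * X (k - 1) \<omega>\<bar> powr \<alpha>)"
        unfolding ar_expmart_def by (intro arg_cong[where f = exp] sum.cong refl) simp
      also have "\<dots> = exp (\<Sum>k=1..n. s * l * (X (k - 1) \<omega> * \<epsilon> k \<omega>)
          - c * l powr \<alpha> * \<bar>X (k - 1) \<omega>\<bar> powr \<alpha>)"
        by (simp only: abs_mult[of "s * l"] \<open>\<bar>s * l\<bar> = l\<close> powr_mult mult.assoc[of "s * l"] mult.assoc[of c])
      finally show ?thesis
        by (simp only: sum_subtractf sum_distrib_left)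
    qed
    \<comment> \<open>Chernoff bound in pointwise form. It is claimed almost everywhere because
      cancelling the denominator of \<open>lse\<close> uses a positive sum of squares.\<close>
    have "AE \<omega> in M. (indicator ?A \<omega> :: ennreal) \<le> ennreal ?K * ennreal (?W (X 0 \<omega>) (?E \<omega>))"
      using assms(11) AE_space
    proof eventually_elim
      case (elim \<omega>)
      let ?S2 = "\<Sum>k=1..n. (X (k - 1) \<omega>)\<^sup>2"
      let ?Sa = "\<Sum>k=1..n. \<bar>X (k - 1) \<omega>\<bar> powr \<alpha>"
      let ?N = "\<Sum>k=1..n. X (k - 1) \<omega> * \<epsilon> k \<omega>"
      have "(lse X n \<omega> - \<theta>) * ?S2 = (\<Sum>k=1..n. X k \<omega> * X (k - 1) \<omega>) - \<theta> * ?S2"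
        using elim(1) by (simp add: lse_def left_diff_distrib)
      also have "\<dots> = (\<Sum>k=1..n. X k \<omega> * X (k - 1) \<omega> - \<theta> * (X (k - 1) \<omega>)\<^sup>2)"
        by (simp add: sum_subtractf sum_distrib_left)
      also have "\<dots> = ?N"
        using assms(10) elim(2) by (intro sum.cong) (auto simp: power2_eq_square algebra_simps)
      finally have N: "(lse X n \<omega> - \<theta>) * ?S2 = ?N" .
      show ?case
      proof (cases "\<omega> \<in> ?A")
        case True
        then have "x \<le> s * ?N" and "?Sa \<le> v powr \<alpha>"
          by (simp_all only: mult.assoc N mem_Collect_eq)
        then have "l * x \<le> l * (s * ?N)" "c * l powr \<alpha> * ?Sa \<le> c * l powr \<alpha> * v powr \<alpha>"
          using l \<open>c > 0\<close> by (auto intro!: mult_left_mono)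
        \<comment> \<open>The total exponent is \<open>(l * (s * ?N) - l * x) + (c * l powr \<alpha>
          * v powr \<alpha> - c * l powr \<alpha> * ?Sa)\<close>, a sum of two nonnegative
          terms.\<close>
        then have "1 \<le> ?K * ?W (X 0 \<omega>) (?E \<omega>)"
          unfolding W_eq[OF elim(2)] exp_add[symmetric] one_le_exp_iff by (simp add: mult_ac)
        then show ?thesis
          using True by (simp add: ar_expmart_def flip: ennreal_mult)
      qed simp
    qed
    then have "(\<integral>\<^sup>+ \<omega>. indicator ?A \<omega> \<partial>M) \<le> (\<integral>\<^sup>+ \<omega>. ennreal ?K * ennreal (?W (X 0 \<omega>) (?E \<omega>)) \<partial>M)"
      by (rule nn_integral_mono_AE)
    also have "(\<integral>\<^sup>+ \<omega>. indicator ?A \<omega> \<partial>M) = emeasure M ?A"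
      using 3 by simp
    \<comment> \<open>The integrand depends on \<open>\<omega>\<close> only through
      \<open>X 0\<close> and the noise vector, so the integral passes to their joint law, which
      factorises.\<close>
    also have "(\<integral>\<^sup>+ \<omega>. ennreal ?K * ennreal (?W (X 0 \<omega>) (?E \<omega>)) \<partial>M)
        = (\<integral>\<^sup>+ p. ennreal ?K * ennreal (?W (fst p) (snd p)) \<partial>distr M (borel \<Otimes>\<^sub>M ?Q) (\<lambda>\<omega>. (X 0 \<omega>, ?E \<omega>)))"
      using measurable_ar_expmart by (subst nn_integral_distr) auto
    also have "distr M (borel \<Otimes>\<^sub>M ?Q) (\<lambda>\<omega>. (X 0 \<omega>, ?E \<omega>)) = distr M borel (X 0) \<Otimes>\<^sub>M PiM {1..n} (\<lambda>_. D)"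
      using distr_pair_indep_rv[OF assms(1,9)] unfolding law_E .
    also have "(\<integral>\<^sup>+ p. ennreal ?K * ennreal (?W (fst p) (snd p)) \<partial>(distr M borel (X 0) \<Otimes>\<^sub>M PiM {1..n} (\<lambda>_. D)))
        = (\<integral>\<^sup>+ x0. \<integral>\<^sup>+ e. ennreal ?K * ennreal (?W x0 e) \<partial>PiM {1..n} (\<lambda>_. D) \<partial>distr M borel (X 0))"
    proof -
      interpret product_prob_space "\<lambda>_::nat. D" "{1..n}"
        using D(1) by (intro product_prob_spaceI)
      have "sets (distr M borel (X 0) \<Otimes>\<^sub>M PiM {1..n} (\<lambda>_. D)) = sets (borel \<Otimes>\<^sub>M ?Q)"
        by (intro sets_pair_measure_cong sets_PiM_cong) (simp_all add: D(2))
      then have "(\<lambda>p. ennreal ?K * ennreal (?W (fst p) (snd p)))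
          \<in> borel_measurable (distr M borel (X 0) \<Otimes>\<^sub>M PiM {1..n} (\<lambda>_. D))"
        using measurable_ar_expmart by (simp cong: measurable_cong_sets)
      from P.nn_integral_fst[OF this] show ?thesis by simp
    qed
    \<comment> \<open>The inner integral is at most \<open>?K\<close> for every initial value, so
      the law of \<open>X 0\<close> contributes only its total mass 1.\<close>
    also have "\<dots> \<le> (\<integral>\<^sup>+ x0. ennreal ?K * 1 \<partial>distr M borel (X 0))"
    proof (rule nn_integral_mono)
      fix x0
      have "?W x0 \<in> borel_measurable (PiM {1..n} (\<lambda>_. D))"
        using D(2) by (rule measurable_ar_expmart_snd)
      then have "(\<integral>\<^sup>+ e. ennreal ?K * ennreal (?W x0 e) \<partial>PiM {1..n} (\<lambda>_. D))
          = ennreal ?K * (\<integral>\<^sup>+ e. ennreal (?W x0 e) \<partial>PiM {1..n} (\<lambda>_. D))"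
        by (intro nn_integral_cmult) simp
      also have "\<dots> \<le> ennreal ?K * 1"
        by (intro mult_left_mono nn_integral_ar_expmart_le_1 D mgf) simp
      finally show "(\<integral>\<^sup>+ e. ennreal ?K * ennreal (?W x0 e) \<partial>PiM {1..n} (\<lambda>_. D)) \<le> ennreal ?K * 1" .
    qed
    also have "\<dots> = ennreal ?K"
      by (simp add: emeasure_distr emeasure_space_1)
    finally show ?thesis
      by (simp add: emeasure_eq_measure exponent)
  qed
qed

end
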